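(* Let $A\in\mathbb{R}_+^{n\times m}$ be a non-negative matrix and let $p\in\mathbb{R}^n_{++}$, $q\in\mathbb{R}^m_{++}$ with $\sum_ip_i=\sum_jq_j$. Suppose $(A,p,q)$ satisfies (Strong Existence) and $A$ satisfies (Uniqueness). Let $$g(u,v)=\sum_{i,j}A_{ij}e^{-v_i+u_j}+\sum_{i=1}^np_iv_i-\sum_{j=1}^mq_ju_j,\qquad u\in\mathbb{R}^m,\ v\in\mathbb{R}^n,$$ $g^\ast:=\inf_{u,v}g(u,v)$, and let $(u^{(t)},v^{(t)})$ be the iterates of Sinkhorn's algorithm started from $u^{(0)}\in\mathbb{R}^m$. Let $$B:=\sup\big\{\|(u,v)\|_\infty:\ (u,v)^T\mathbf{1}_{m+n}=0,\ g(u,v)\le g(u^{(0)},v^{(0)})\big\},$$ let $\mathcal{L}$ be the bipartite graph Laplacian of $A$, let $\lambda_{-2}(\mathcal{L})$ be its second smallest eigenvalue, and let $l_0=\max_j(A^T\mathbf{1}_n)_j$, $l_1=\max_i(A\mathbf{1}_m)_i$. Then $B<\infty$ and for all $t>0$, $$g(u^{(t+1)},v^{(t+1)})-g^\ast\le\Big(1-e^{-4B}\,\frac{\lambda_{-2}(\mathcal{L})}{\min\{l_0,l_1\}}\Big)\big(g(u^{(t)},v^{(t)})-g^\ast\big).$$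
   Context: (Strong Existence): there exists a non-negative $A'\in\mathbb{R}_+^{n\times m}$ with the same zero pattern as $A$ ($A'_{ij}=0\iff A_{ij}=0$) and with row sums $p$ and column sums $q$. It is well known that this is equivalent to: for every $N\subsetneq[n]$, $M\subsetneq[m]$ with $A_{ij}=0$ for all $i\notin N$, $j\in M$, one has $\sum_{i\in N}p_i\ge\sum_{j\in M}q_j$, with equality iff also $A_{ij}=0$ for all $i\in N$, $j\notin M$. (Uniqueness): $A$ is indecomposable, i.e. there are no permutation matrices $P,Q$ such that $PAQ$ is block diagonal (at least two blocks, possibly rectangular); equivalently the bipartite graph on $[n]\sqcup[m]$ with an edge $\{i,j\}$ iff $A_{ij}>0$ is connected. Sinkhorn's algorithm in the variables $(u,v)$ is alternating minimization of $g$: $v^{(0)}=\arg\min_vg(u^{(0)},v)$ and, for $t\ge1$, $u^{(t)}=\arg\min_ug(u,v^{(t-1)})$, $v^{(t)}=\arg\min_vg(u^{(t)},v)$; explicitly $$u_j^{(t)}=\log\frac{q_j}{\sum_iA_{ij}e^{-v_i^{(t-1)}}},\qquad v_i^{(t)}=-\log\frac{p_i}{\sum_jA_{ij}e^{u_j^{(t)}}}.$$ With $d^0=e^u$ and $d^1=e^{-v}$ this is the usual iteration $d^1\leftarrow p/(Ad^0)$, $d^0\leftarrow q/(A^Td^1)$. The bipartite graph Laplacian is $$\mathcal{L}=\begin{bmatrix}\mathcal{D}(A\mathbf{1}_m)&-A\\-A^T&\mathcal{D}(A^T\mathbf{1}_n)\end{bmatrix}\in\mathbb{R}^{(n+m)\times(n+m)},$$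 where $\mathcal{D}(x)$ is the diagonal matrix with diagonal $x$; it is symmetric positive semidefinite, and its eigenvalues are counted with multiplicity. $\mathbf{1}_k$ is the all-ones vector in $\mathbb{R}^k$. *)

theory Defs
  imports "HOL-Analysis.Analysis" "HOL-Computational_Algebra.Polynomial"
begin

section \<open>Matrix scaling\<close>

definition strong_existence :: "real^'m^'n \<Rightarrow> real^'n \<Rightarrow> real^'m \<Rightarrow> bool" where
  "strong_existence A p q \<longleftrightarrow>
     (\<exists>A' :: real^'m^'n. (\<forall>i j. 0 \<le> A' $ i $ j)
        \<and> (\<forall>i j. A' $ i $ j = 0 \<longleftrightarrow> A $ i $ j = 0)
        \<and> A' *v 1 = p \<and> transpose A' *v 1 = q)"

text \<open>The index types carry no order, so permuting the rows and columns amounts to choosing the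
  enumerations \<open>r\<close> and \<open>c\<close>.  The reordered matrix is then block diagonal with diagonal blocks of
  format \<open>k \<times> l\<close> and \<open>(n - k) \<times> (m - l)\<close>; further blocks can be merged into the second one.
  As usual for rectangular blocks, a block may have no columns or no rows (a zero row or a
  zero column of the matrix), but not neither.\<close>

definition decomposable :: "real^'m^'n \<Rightarrow> bool" where
  "decomposable A \<longleftrightarrow>
     (\<exists>(r :: 'n \<Rightarrow> nat) (c :: 'm \<Rightarrow> nat) k l.
        bij_betw r UNIV {..<CARD('n)} \<and> bij_betw c UNIV {..<CARD('m)}
        \<and> k \<le> CARD('n) \<and> l \<le> CARD('m)
        \<and> (k, l) \<noteq> (0, 0) \<and> (k, l) \<noteq> (CARD('n), CARD('m))
        \<and> (\<forall>i j. (r i < k) \<noteq> (c j < l) \<longrightarrow> A $ i $ j = 0))"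

abbreviation indecomposable :: "real^'m^'n \<Rightarrow> bool" where
  "indecomposable A \<equiv> \<not> decomposable A"

definition bipartite_edges :: "real^'m^'n \<Rightarrow> (('n + 'm) \<times> ('n + 'm)) set" where
  "bipartite_edges A = {(Inl i, Inr j) | i j. A $ i $ j > 0} \<union> {(Inr j, Inl i) | i j. A $ i $ j > 0}"

lemma enumeration_onto_initial_segment:
  fixes N :: "'k::finite set"
  obtains r :: "'k \<Rightarrow> nat" where "bij_betw r UNIV {..<CARD('k)}" "\<And>i. r i < card N \<longleftrightarrow> i \<in> N"
proof -
  obtain f where f: "bij_betw f N {0..<card N}"
    using ex_bij_betw_finite_nat[of N] by auto
  obtain g where g: "bij_betw g (- N) {0..<card (- N)}"
    using ex_bij_betw_finite_nat[of "- N"] by auto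
  define r where "r i = (if i \<in> N then f i else card N + g i)" for i
  have cN: "card N + card (- N) = CARD('k)"
    by (metis Compl_partition card_Un_disjoint Compl_disjoint finite)
  have 1: "bij_betw r N {0..<card N}"
    using f by (rule bij_betw_cong[THEN iffD1, rotated]) (auto simp: r_def)
  have "bij_betw (\<lambda>x. card N + x) {0..<card (- N)} {card N..<card N + card (- N)}"
    by (simp add: bij_betw_def add.commute)
  from bij_betw_trans[OF g this]
  have 2: "bij_betw r (- N) {card N..<CARD('k)}"
    unfolding cN by (rule bij_betw_cong[THEN iffD1, rotated]) (auto simp: r_def)
  have "bij_betw r (N \<union> - N) ({0..<card N} \<union> {card N..<CARD('k)})"
    by (rule bij_betw_combine[OF 1 2]) auto
  moreover have "{0..<card N} \<union> {card N..<CARD('k)} = {..<CARD('k)}"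
    using cN by auto
  ultimately have "bij_betw r UNIV {..<CARD('k)}" by simp
  moreover have "r i < card N \<longleftrightarrow> i \<in> N" for i
    using bij_betwE[OF 1] by (auto simp: r_def)
  ultimately show thesis by (rule that)
qed

lemma decomposable_iff_partition:
  fixes A :: "real^'m^'n"
  shows "decomposable A \<longleftrightarrow>
    (\<exists>N M. (N, M) \<noteq> ({}, {}) \<and> (N, M) \<noteq> (UNIV, UNIV)
       \<and> (\<forall>i j. (i \<in> N) \<noteq> (j \<in> M) \<longrightarrow> A $ i $ j = 0))" (is "_ \<longleftrightarrow> ?P")
proof
  assume "decomposable A"
  then obtain r :: "'n \<Rightarrow> nat" and c :: "'m \<Rightarrow> nat" and k l where
    rc: "bij_betw r UNIV {..<CARD('n)}" "bij_betw c UNIV {..<CARD('m)}"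
    and kl: "k \<le> CARD('n)" "l \<le> CARD('m)" "(k, l) \<noteq> (0, 0)" "(k, l) \<noteq> (CARD('n), CARD('m))"
    and z: "\<forall>i j. (r i < k) \<noteq> (c j < l) \<longrightarrow> A $ i $ j = 0"
    unfolding decomposable_def by blast
  have *: "({i. s i < b} = {} \<longleftrightarrow> b = 0) \<and> ({i. s i < b} = UNIV \<longleftrightarrow> b = CARD('k))"
    if "bij_betw s UNIV {..<CARD('k)}" "b \<le> CARD('k)" for s :: "'k::finite \<Rightarrow> nat" and b
  proof -
    have "s ` {i. s i < b} = {..<b}"
    proof (intro equalityI subsetI)
      fix y assume "y \<in> {..<b}"
      then have "y \<in> range s" using that by (auto simp: bij_betw_def)
      then show "y \<in> s ` {i. s i < b}" using \<open>y \<in> {..<b}\<close> by auto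
    qed auto
    then have "card {i. s i < b} = b"
      using that(1) by (metis bij_betw_def card_image card_lessThan inj_on_subset subset_UNIV)
    then show ?thesis
      by (metis card.empty card_eq_UNIV_imp_eq_UNIV card_0_eq finite)
  qed
  show ?P
    using *[OF rc(1) kl(1)] *[OF rc(2) kl(2)] kl z
    by (intro exI[of _ "{i. r i < k}"] exI[of _ "{j. c j < l}"]) auto
next
  assume ?P
  then obtain N M where NM: "(N, M) \<noteq> ({}, {})" "(N, M) \<noteq> (UNIV, UNIV)"
    and z: "\<forall>i j. (i \<in> N) \<noteq> (j \<in> M) \<longrightarrow> A $ i $ j = 0"
    by (elim exE conjE) (rule that)
  obtain r :: "'n \<Rightarrow> nat" where r: "bij_betw r UNIV {..<CARD('n)}" "\<And>i. r i < card N \<longleftrightarrow> i \<in> N"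
    using enumeration_onto_initial_segment by blast
  obtain c :: "'m \<Rightarrow> nat" where c: "bij_betw c UNIV {..<CARD('m)}" "\<And>i. c i < card M \<longleftrightarrow> i \<in> M"
    using enumeration_onto_initial_segment by blast
  have "(card N, card M) \<noteq> (0, 0)" "(card N, card M) \<noteq> (CARD('n), CARD('m))"
    using NM card_eq_UNIV_imp_eq_UNIV[of N] card_eq_UNIV_imp_eq_UNIV[of M]
    by (metis card_0_eq finite prod.inject)+
  moreover have "card N \<le> CARD('n)" "card M \<le> CARD('m)" by (rule card_mono; simp)+
  ultimately show "decomposable A"
    unfolding decomposable_def
    apply -
    apply (rule exI[of _ r], rule exI[of _ c], rule exI[of _ "card N"], rule exI[of _ "card M"])
    apply (simp only: r c simp_thms)
    apply (use z in blast)
    done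
qed

theorem indecomposable_iff_connected:
  fixes A :: "real^'m^'n"
  assumes "\<forall>i j. 0 \<le> A $ i $ j"
  shows "indecomposable A \<longleftrightarrow> (\<forall>x y. (x, y) \<in> (bipartite_edges A)\<^sup>*)"
proof
  assume ind: "indecomposable A"
  show "\<forall>x y. (x, y) \<in> (bipartite_edges A)\<^sup>*"
  proof (rule ccontr)
    assume "\<not> ?thesis"
    then obtain x y where xy: "(x, y) \<notin> (bipartite_edges A)\<^sup>*" by blast
    define R where "R = {z. (x, z) \<in> (bipartite_edges A)\<^sup>*}"
    have R: "x \<in> R" "y \<notin> R" using xy by (auto simp: R_def)
    have cl: "b \<in> R" if "a \<in> R" "(a, b) \<in> bipartite_edges A" for a b
      using that by (auto simp: R_def)
    define N M where "N = {i. Inl i \<in> R}" and "M = {j. Inr j \<in> R}"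
    have "A $ i $ j = 0" if "(i \<in> N) \<noteq> (j \<in> M)" for i j
    proof (rule ccontr)
      assume "A $ i $ j \<noteq> 0"
      with assms have "A $ i $ j > 0" by (simp add: order_less_le)
      then have "(Inl i, Inr j) \<in> bipartite_edges A" "(Inr j, Inl i) \<in> bipartite_edges A"
        by (auto simp: bipartite_edges_def)
      with cl that show False by (auto simp: N_def M_def)
    qed
    moreover have "(N, M) \<noteq> ({}, {})" using R(1) by (cases x) (auto simp: N_def M_def)
    moreover have "(N, M) \<noteq> (UNIV, UNIV)" using R(2) by (cases y) (auto simp: N_def M_def)
    ultimately have "decomposable A"
      unfolding decomposable_iff_partition by (intro exI[of _ N] exI[of _ M]) simp
    with ind show False ..
  qed
next
  assume con: "\<forall>x y. (x, y) \<in> (bipartite_edges A)\<^sup>*"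
  show "indecomposable A"
  proof
    assume "decomposable A"
    then obtain N M where NM: "(N, M) \<noteq> ({}, {})" "(N, M) \<noteq> (UNIV, UNIV)"
      and z: "\<forall>i j. (i \<in> N) \<noteq> (j \<in> M) \<longrightarrow> A $ i $ j = 0"
      unfolding decomposable_iff_partition by (elim exE conjE) (rule that)
    define R where "R = Inl ` N \<union> Inr ` M"
    have "b \<in> R" if "(a, b) \<in> (bipartite_edges A)\<^sup>*" "a \<in> R" for a b
      using that
    proof (induction rule: rtrancl_induct)
      case (step y w)
      then obtain i j where ij: "A $ i $ j > 0"
        and yw: "(y, w) = (Inl i, Inr j) \<or> (y, w) = (Inr j, Inl i)"
        by (auto simp: bipartite_edges_def)
      from ij z have "i \<in> N \<longleftrightarrow> j \<in> M" by (metis less_irrefl)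
      with yw step show ?case by (auto simp: R_def)
    qed
    moreover obtain x where "x \<in> R" using NM(1) by (auto simp: R_def)
    moreover obtain y where "y \<notin> R" using NM(2) by (auto simp: R_def)
    ultimately show False using con by blast
  qed
qed

section \<open>The dual objective and Sinkhorn's algorithm\<close>

definition sinkhorn_g :: "real^'m^'n \<Rightarrow> real^'n \<Rightarrow> real^'m \<Rightarrow> real^'m \<Rightarrow> real^'n \<Rightarrow> real" where
  "sinkhorn_g A p q u v =
     (\<Sum>i\<in>UNIV. \<Sum>j\<in>UNIV. A $ i $ j * exp (- v $ i + u $ j))
     + (\<Sum>i\<in>UNIV. p $ i * v $ i) - (\<Sum>j\<in>UNIV. q $ j * u $ j)"

text \<open>This is a genuine infimum under strong existence; see \<open>sinkhorn_g_bdd_below\<close>.\<close>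

definition sinkhorn_g_star :: "real^'m^'n \<Rightarrow> real^'n \<Rightarrow> real^'m \<Rightarrow> real" where
  "sinkhorn_g_star A p q = (INF (u, v)\<in>UNIV. sinkhorn_g A p q u v)"

definition sinkhorn_iterates ::
  "real^'m^'n \<Rightarrow> real^'n \<Rightarrow> real^'m \<Rightarrow> (nat \<Rightarrow> real^'m) \<Rightarrow> (nat \<Rightarrow> real^'n) \<Rightarrow> bool" where
  "sinkhorn_iterates A p q u v \<longleftrightarrow>
     (\<forall>t. is_arg_min (\<lambda>y. sinkhorn_g A p q (u t) y) (\<lambda>_. True) (v t))
     \<and> (\<forall>t. is_arg_min (\<lambda>x. sinkhorn_g A p q x (v t)) (\<lambda>_. True) (u (Suc t)))"

text \<open>The supremum is taken in the extended reals, so that its finiteness can be asserted.\<close>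

definition sinkhorn_B ::
  "real^'m^'n \<Rightarrow> real^'n \<Rightarrow> real^'m \<Rightarrow> real^'m \<Rightarrow> real^'n \<Rightarrow> ereal" where
  "sinkhorn_B A p q u0 v0 =
     Sup {ereal (infnorm (u, v)) | u v.
            (u, v) \<bullet> (1, 1) = 0 \<and> sinkhorn_g A p q u v \<le> sinkhorn_g A p q u0 v0}"

lemma sinkhorn_g_bdd_below:
  assumes A: "\<forall>i j. 0 \<le> A $ i $ j" and ex: "strong_existence A p q"
  shows "bdd_below (range (\<lambda>(u, v). sinkhorn_g A p q u v))"
proof -
  obtain A' where nn: "\<And>i j. 0 \<le> A' $ i $ j" and zp: "\<And>i j. A' $ i $ j = 0 \<longleftrightarrow> A $ i $ j = 0"
    and p: "p = A' *v 1" and q: "q = transpose A' *v 1"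
    using ex unfolding strong_existence_def by blast
  define c where "c i j = (if A $ i $ j = 0 then 0
      else A' $ i $ j * (1 + ln (A $ i $ j / A' $ i $ j)))" for i j
  have le: "c i j \<le> A $ i $ j * exp (- x) + A' $ i $ j * x" for i j x
  proof (cases "A $ i $ j = 0")
    case True
    then show ?thesis using zp[of i j] by (simp add: c_def)
  next
    case False
    let ?a = "A $ i $ j" and ?b = "A' $ i $ j"
    have ab: "?a > 0" "?b > 0" using False A nn zp by (metis order_less_le)+
    have "1 + (ln (?a / ?b) - x) \<le> exp (ln (?a / ?b) - x)" by (rule exp_ge_add_one_self)
    also have "\<dots> = ?a / ?b * exp (- x)" using ab by (simp add: exp_diff exp_minus divide_inverse)
    finally have "?b * (1 + (ln (?a / ?b) - x)) \<le> ?b * (?a / ?b * exp (- x))"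
      using ab by (intro mult_left_mono) auto
    then show ?thesis using ab False by (simp add: c_def algebra_simps)
  qed
  have "(\<Sum>i\<in>UNIV. \<Sum>j\<in>UNIV. c i j) \<le> sinkhorn_g A p q u v" for u v
  proof -
    have "sinkhorn_g A p q u v = (\<Sum>i\<in>UNIV. \<Sum>j\<in>UNIV.
        A $ i $ j * exp (- (v $ i - u $ j)) + A' $ i $ j * (v $ i - u $ j))"
    proof -
      have "(\<Sum>j\<in>UNIV. q $ j * u $ j) = (\<Sum>i\<in>UNIV. \<Sum>j\<in>UNIV. A' $ i $ j * u $ j)"
        unfolding q by (subst sum.swap)
          (simp add: matrix_vector_mult_def transpose_def sum_distrib_right)
      moreover have "(\<Sum>i\<in>UNIV. p $ i * v $ i) = (\<Sum>i\<in>UNIV. \<Sum>j\<in>UNIV. A' $ i $ j * v $ i)"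
        unfolding p by (simp add: matrix_vector_mult_def sum_distrib_right)
      ultimately show ?thesis
        by (simp add: sinkhorn_g_def sum.distrib sum_subtractf right_diff_distrib)
    qed
    then show ?thesis by (simp only: sum_mono le)
  qed
  then show ?thesis by (intro bdd_belowI2) auto
qed

lemma is_arg_min_separable_exp:
  fixes r p x :: "real^'k" and s :: real
  assumes r: "\<And>i. r $ i > 0" and p: "\<And>i. p $ i > 0" and s: "s = 1 \<or> s = - 1"
  shows "is_arg_min (\<lambda>x. (\<Sum>i\<in>UNIV. r $ i * exp (- (s * x $ i)) + p $ i * (s * x $ i)) + c)
           (\<lambda>_. True) x \<longleftrightarrow> (\<forall>i. s * x $ i = - ln (p $ i / r $ i))"
    (is "is_arg_min ?F _ x \<longleftrightarrow> _")
proof -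
  define z :: "real^'k" where "z = (\<chi> i. s * - ln (p $ i / r $ i))"
  have ss: "s * (s * a) = a" for a using s by auto
  have z: "s * z $ i = - ln (p $ i / r $ i)" for i
    unfolding z_def by (simp only: vec_lambda_beta ss)
  define d where "d y i = s * y $ i + ln (p $ i / r $ i)" for y :: "real^'k" and i
  have d: "?F y - ?F z = (\<Sum>i\<in>UNIV. p $ i * (exp (- d y i) - 1 + d y i))" for y
  proof -
    have "(r $ i * exp (- (s * y $ i)) + p $ i * (s * y $ i)) -
          (r $ i * exp (- (s * z $ i)) + p $ i * (s * z $ i))
        = p $ i * (exp (- d y i) - 1 + d y i)" for i
      unfolding z d_def using r[of i] p[of i]
      by (simp add: exp_diff exp_minus field_simps)
    then show ?thesis by (simp add: sum_subtractf[symmetric])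
  qed
  have nn: "p $ i * (exp (- d y i) - 1 + d y i) \<ge> 0" for y i
    using p[of i] exp_ge_add_one_self[of "- d y i"] by (intro mult_nonneg_nonneg) auto
  have eq: "?F y \<le> ?F z \<longleftrightarrow> (\<forall>i. d y i = 0)" for y
  proof -
    have "?F y \<le> ?F z \<longleftrightarrow> (\<Sum>i\<in>UNIV. p $ i * (exp (- d y i) - 1 + d y i)) = 0"
      using d[of y] sum_nonneg[of UNIV "\<lambda>i. p $ i * (exp (- d y i) - 1 + d y i)"] nn[of _ y]
      by fastforce
    also have "\<dots> \<longleftrightarrow> (\<forall>i. p $ i * (exp (- d y i) - 1 + d y i) = 0)"
      by (subst sum_nonneg_eq_0_iff) (use nn in auto)
    also have "\<dots> \<longleftrightarrow> (\<forall>i. d y i = 0)"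
    proof -
      have "exp (- w) - 1 + w = 0 \<longleftrightarrow> w = 0" for w :: real
        using ln_eq_minus_one[of "exp (- w)"] by auto
      then show ?thesis using p by (metis mult_eq_0_iff less_irrefl)
    qed
    finally show ?thesis .
  qed
  have min: "?F z \<le> ?F y" for y using d[of y] nn by (smt (verit) sum_nonneg)
  have "is_arg_min ?F (\<lambda>_. True) x \<longleftrightarrow> ?F x \<le> ?F z"
    unfolding is_arg_min_def using min by (meson not_le order_trans)
  then show ?thesis unfolding eq by (auto simp: d_def add_eq_0_iff)
qed

theorem sinkhorn_iterates_iff_explicit:
  fixes A :: "real^'m^'n"
  assumes A: "\<forall>i j. 0 \<le> A $ i $ j" and p: "\<forall>i. 0 < p $ i" and q: "\<forall>j. 0 < q $ j"
    and ex: "strong_existence A p q"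
  shows "sinkhorn_iterates A p q u v \<longleftrightarrow>
    (\<forall>t i. v t $ i = - ln (p $ i / (\<Sum>j\<in>UNIV. A $ i $ j * exp (u t $ j))))
    \<and> (\<forall>t j. u (Suc t) $ j = ln (q $ j / (\<Sum>i\<in>UNIV. A $ i $ j * exp (- v t $ i))))"
proof -
  obtain A' where nn: "\<And>i j. 0 \<le> A' $ i $ j" and zp: "\<And>i j. A' $ i $ j = 0 \<longleftrightarrow> A $ i $ j = 0"
    and p': "p = A' *v 1" and q': "q = transpose A' *v 1"
    using ex unfolding strong_existence_def by blast
  have row: "\<exists>j. A $ i $ j > 0" for i
  proof (rule ccontr)
    assume "\<not> ?thesis"
    then have "A' $ i $ j = 0" for j using A zp by (metis order_less_le)
    then have "p $ i = 0" by (simp add: p' matrix_vector_mult_def)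
    with p show False by (metis less_irrefl)
  qed
  have col: "\<exists>i. A $ i $ j > 0" for j
  proof (rule ccontr)
    assume "\<not> ?thesis"
    then have "A' $ i $ j = 0" for i using A zp by (metis order_less_le)
    then have "q $ j = 0" by (simp add: q' matrix_vector_mult_def transpose_def)
    with q show False by (metis less_irrefl)
  qed
  have "is_arg_min (\<lambda>y. sinkhorn_g A p q x y) (\<lambda>_. True) y \<longleftrightarrow>
      (\<forall>i. y $ i = - ln (p $ i / (\<Sum>j\<in>UNIV. A $ i $ j * exp (x $ j))))" for x y
  proof -
    define r :: "real^'n" where "r = (\<chi> i. \<Sum>j\<in>UNIV. A $ i $ j * exp (x $ j))"
    have r: "r $ i > 0" for i
    proof -
      obtain j where "A $ i $ j > 0" using row[of i] by blast
      then show ?thesis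
        using A by (simp add: r_def, intro sum_pos2[of UNIV j]) auto
    qed
    have eq: "sinkhorn_g A p q x = (\<lambda>y. (\<Sum>i\<in>UNIV. r $ i * exp (- (1 * y $ i)) + p $ i * (1 * y $ i))
        + - (\<Sum>j\<in>UNIV. q $ j * x $ j))"
      by (simp add: fun_eq_iff sinkhorn_g_def r_def sum.distrib sum_distrib_right sum_distrib_left
          exp_diff exp_minus divide_inverse mult_ac)
    show ?thesis unfolding eq
      by (subst is_arg_min_separable_exp) (use r p in \<open>auto simp: r_def\<close>)
  qed
  moreover have "is_arg_min (\<lambda>x. sinkhorn_g A p q x y) (\<lambda>_. True) x \<longleftrightarrow>
      (\<forall>j. x $ j = ln (q $ j / (\<Sum>i\<in>UNIV. A $ i $ j * exp (- y $ i))))" for x y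
  proof -
    define r :: "real^'m" where "r = (\<chi> j. \<Sum>i\<in>UNIV. A $ i $ j * exp (- y $ i))"
    have r: "r $ j > 0" for j
    proof -
      obtain i where "A $ i $ j > 0" using col[of j] by blast
      then show ?thesis
        using A by (simp add: r_def, intro sum_pos2[of UNIV i]) auto
    qed
    have "(\<Sum>i\<in>UNIV. \<Sum>j\<in>UNIV. A $ i $ j * exp (- y $ i + x $ j)) =
        (\<Sum>j\<in>UNIV. r $ j * exp (x $ j))" for x :: "real^'m"
      by (subst sum.swap) (simp add: r_def sum_distrib_left sum_distrib_right exp_diff exp_minus divide_inverse mult_ac)
    then have eq: "(\<lambda>x. sinkhorn_g A p q x y) =
        (\<lambda>x. (\<Sum>j\<in>UNIV. r $ j * exp (- (- 1 * x $ j)) + q $ j * (- 1 * x $ j))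
        + (\<Sum>i\<in>UNIV. p $ i * y $ i))"
      by (simp add: fun_eq_iff sinkhorn_g_def sum_subtractf)
    show ?thesis unfolding eq
      by (subst is_arg_min_separable_exp) (use r q in \<open>auto simp: r_def\<close>)
  qed
  ultimately show ?thesis by (simp add: sinkhorn_iterates_def)
qed

section \<open>The bipartite graph Laplacian and its spectrum\<close>

definition diag_mat :: "real^'k \<Rightarrow> real^'k^'k" where
  "diag_mat x = (\<chi> i j. if i = j then x $ i else 0)"

definition bipartite_laplacian :: "real^'m^'n \<Rightarrow> real^('n + 'm)^('n + 'm)" where
  "bipartite_laplacian A = (\<chi> a b.
     case (a, b) of
       (Inl i, Inl i') \<Rightarrow> diag_mat (A *v 1) $ i $ i'
     | (Inl i, Inr j) \<Rightarrow> - (A $ i $ j)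
     | (Inr j, Inl i) \<Rightarrow> - (transpose A $ j $ i)
     | (Inr j, Inr j') \<Rightarrow> diag_mat (transpose A *v 1) $ j $ j')"

definition charpoly :: "real^'k^'k \<Rightarrow> real poly" where
  "charpoly M = det (mat [:0, 1:] - (\<chi> i j. [:M $ i $ j:]))"

text \<open>Only real eigenvalues are collected; for a symmetric matrix these are all of them.\<close>

definition eigenvalues_mset :: "real^'k^'k \<Rightarrow> real multiset" where
  "eigenvalues_mset M = proots (charpoly M)"

definition second_smallest_eigenvalue :: "real^'k^'k \<Rightarrow> real" where
  "second_smallest_eigenvalue M = sorted_list_of_multiset (eigenvalues_mset M) ! 1"

end

theory Submission
  imports Defs
begin

text \<open>The Hessian of \<open>g\<close> at \<open>(u, v)\<close> is the bipartite Laplacian of the scaled matrix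
  \<open>A\<^sub>i\<^sub>j exp (u\<^sub>j - v\<^sub>i)\<close>.  Since \<open>g\<close> is invariant under adding a common constant to all
  coordinates, \<open>\<bar>u\<^sub>j - v\<^sub>i\<bar> \<le> 2B\<close> on the level set of the starting point, so there \<open>g\<close> is strongly
  convex orthogonally to \<open>1\<close> with modulus \<open>exp (- 2B) \<lambda>\<close>, \<open>\<lambda>\<close> being the second smallest eigenvalue;
  hence \<open>2 exp (- 2B) \<lambda> (g - g\<^sup>*) \<le> |\<nabla>g|\<^sup>2\<close>.  After a half step one block of the gradient vanishes, and
  exact minimization over the other block decreases \<open>g\<close> by at least \<open>|\<nabla>g|\<^sup>2 / (2 exp (2B) l)\<close>, where
  \<open>l\<close> is \<open>l\<^sub>0\<close> or \<open>l\<^sub>1\<close> depending on the block, so either half step alone yields a contraction.\<close>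

section \<open>Scalar inequalities for exponential and logarithm\<close>

text \<open>Taylor's formula with Lagrange remainder: the intermediate point is at least
  \<open>- c\<close>, so the second derivative there is at least \<open>exp (- c)\<close>.\<close>

lemma exp_ge_second_order:
  fixes a b c :: real
  assumes "- c \<le> a" "- c \<le> b"
  shows "exp a + exp a * (b - a) + exp (- c) / 2 * (b - a)\<^sup>2 \<le> exp b"
proof (cases "a = b")
  case False
  define l u where "l = min a b" and "u = max a b"
  have "\<exists>t. (if b < a then b < t \<and> t < a else a < t \<and> t < b) \<and>
      exp b = (\<Sum>m<2. exp a / fact m * (b - a) ^ m) + exp t / fact 2 * (b - a) ^ 2"
    by (rule Taylor[where a = l and b = u and diff = "\<lambda>_. exp"])
      (use False in \<open>auto simp: l_def u_def\<close>)
  then obtain t where t: "- c \<le> t"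
    and eq: "exp b = exp a + exp a * (b - a) + exp t / 2 * (b - a)\<^sup>2"
    using assms by (auto simp: eval_nat_numeral split: if_splits)
  have "exp (- c) / 2 * (b - a)\<^sup>2 \<le> exp t / 2 * (b - a)\<^sup>2"
    using t by (intro mult_right_mono) auto
  with eq show ?thesis by simp
qed simp

text \<open>Both sides vanish at \<open>c = q\<close>, and their difference has derivative
  \<open>(x - q) * (1 / x - 1 / M)\<close>, which is \<le> 0 below \<open>q\<close> and \<ge> 0
  between \<open>q\<close> and \<open>M\<close>. The right-hand side is a Kullback-Leibler
  term.\<close>

lemma entropy_gap_ge_square:
  fixes c q M :: real
  assumes "0 < c" "0 < q" "c \<le> M" "q \<le> M"
  shows "(c - q)\<^sup>2 / (2 * M) \<le> c - q - q * ln (c / q)"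
proof -
  define G where "G x = x - q - q * ln (x / q) - (x - q)\<^sup>2 / (2 * M)" for x
  have D: "(G has_real_derivative (x - q) * (1 / x - 1 / M)) (at x)" if "0 < x" for x
    unfolding G_def using that assms
    by (auto intro!: derivative_eq_intros simp: field_simps power2_eq_square)
  have "G q \<le> G c"
  proof (cases "q \<le> c")
    case True
    show ?thesis
    proof (rule DERIV_nonneg_imp_nondecreasing[OF True])
      fix x assume "q \<le> x" "x \<le> c"
      then show "\<exists>y. (G has_real_derivative y) (at x) \<and> 0 \<le> y"
        using assms by (intro exI[of _ "(x - q) * (1 / x - 1 / M)"] conjI D mult_nonneg_nonneg)
          (auto simp: field_simps)
    qed
  next
    case False
    then have "c \<le> q" by simp
    then show ?thesis
    proof (rule DERIV_nonpos_imp_nonincreasing)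
      fix x assume "c \<le> x" "x \<le> q"
      then show "\<exists>y. (G has_real_derivative y) (at x) \<and> y \<le> 0"
        using assms by (intro exI[of _ "(x - q) * (1 / x - 1 / M)"] conjI D mult_nonpos_nonneg)
          (auto simp: field_simps)
    qed
  qed
  then show ?thesis using assms by (simp add: G_def)
qed

section \<open>Rayleigh quotients and the characteristic polynomial\<close>

text \<open>The Rayleigh quotient attains its minimum on the compact unit sphere of
  \<open>S\<close>. By invariance the residual \<open>y\<close> of the minimizer lies in
  \<open>S\<close>, so it is an admissible direction of variation and must vanish.\<close>

lemma rayleigh_minimizer_invariant_subspace:
  fixes M :: "real^'k^'k"
  assumes sym: "\<And>x y. x \<bullet> (M *v y) = (M *v x) \<bullet> y"
    and S: "subspace S" "S \<noteq> {0}" and inv: "\<And>x. x \<in> S \<Longrightarrow> M *v x \<in> S"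
  obtains w \<mu> where "w \<in> S" "w \<noteq> 0" "M *v w = \<mu> *\<^sub>R w"
    "\<And>z. z \<in> S \<Longrightarrow> \<mu> * (z \<bullet> z) \<le> z \<bullet> (M *v z)"
proof -
  define Q where "Q z = z \<bullet> (M *v z)" for z
  let ?K = "sphere 0 1 \<inter> S"
  have "compact ?K"
    using S(1) by (intro compact_Int_closed compact_sphere closed_subspace)
  moreover obtain x where x: "x \<in> S" "x \<noteq> 0" using S subspace_0[OF S(1)] by blast
  then have "x /\<^sub>R norm x \<in> ?K" using S(1) by (auto intro: subspace_scale)
  then have "?K \<noteq> {}" by blast
  moreover have "continuous_on ?K Q"
    unfolding Q_def by (intro continuous_intros matrix_vector_mult_linear_continuous_on)
  ultimately obtain w where w: "w \<in> ?K" and min: "\<And>z. z \<in> ?K \<Longrightarrow> Q w \<le> Q z"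
    using continuous_attains_inf by metis
  define \<mu> where "\<mu> = Q w"
  have ww: "w \<bullet> w = 1" using w by (simp add: dot_square_norm)
  have ray: "\<mu> * (z \<bullet> z) \<le> Q z" if z: "z \<in> S" for z
  proof (cases "z = 0")
    case False
    then have "z /\<^sub>R norm z \<in> ?K" using z S(1) by (auto intro: subspace_scale)
    from min[OF this] have "\<mu> \<le> Q z / (norm z)\<^sup>2"
      by (simp add: \<mu>_def Q_def matrix_vector_mult_scaleR power2_eq_square field_simps)
    with False show ?thesis by (simp add: dot_square_norm field_simps)
  qed (simp add: Q_def)
  define y where "y = M *v w - \<mu> *\<^sub>R w"
  have yS: "y \<in> S" unfolding y_def using w inv S(1) by (auto intro: subspace_diff subspace_scale)
  \<comment> \<open>The quadratic \<open>Q - \<mu> |\<cdot>|\<^sup>2\<close> is nonnegative on \<open>S\<close> and vanishes at \<open>w\<close>, so its derivative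
     at \<open>w\<close> in the direction \<open>y\<close> is zero.\<close>
  define b where "b = Q y - \<mu> * (y \<bullet> y)"
  have quad: "0 \<le> 2 * t * (y \<bullet> y) + t\<^sup>2 * b" for t
  proof -
    have "w + t *\<^sub>R y \<in> S" using w yS S(1) by (auto intro: subspace_add subspace_scale)
    from ray[OF this] have "0 \<le> Q (w + t *\<^sub>R y) - \<mu> * ((w + t *\<^sub>R y) \<bullet> (w + t *\<^sub>R y))" by simp
    also have "Q (w + t *\<^sub>R y) = Q w + 2 * t * (y \<bullet> (M *v w)) + t\<^sup>2 * Q y"
      using sym[of w y]
      by (simp add: Q_def matrix_vector_right_distrib matrix_vector_mult_scaleR inner_simps
          power2_eq_square inner_commute algebra_simps)
    also have "y \<bullet> (M *v w) = y \<bullet> y + \<mu> * (y \<bullet> w)"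
      by (simp add: y_def inner_simps inner_commute algebra_simps)
    finally show ?thesis
      by (simp add: b_def inner_simps ww \<mu>_def[symmetric] power2_eq_square inner_commute algebra_simps)
  qed
  have "y \<bullet> y = 0"
  proof (rule ccontr)
    assume ny: "y \<bullet> y \<noteq> 0"
    then have pos: "y \<bullet> y > 0" by simp
    \<comment> \<open>\<open>t = - 1\<close> gives \<open>b \<ge> 2 * (y \<bullet> y)\<close>; at
      its minimizer \<open>- (y \<bullet> y) / b\<close> the quadratic is then negative.\<close>
    have "b > 0" using quad[of "-1"] pos by (simp, linarith)
    then show False
      using quad[of "- (y \<bullet> y) / b"] mult_pos_pos[OF pos pos]
      by (simp add: power2_eq_square field_simps)
  qed
  then have "M *v w = \<mu> *\<^sub>R w" by (simp add: y_def)
  moreover have "w \<noteq> 0" using ww by auto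
  ultimately show thesis using that w ray unfolding Q_def by blast
qed

lemma poly_charpoly: "poly (charpoly M) x = det (x *\<^sub>R mat 1 - M)"
proof -
  have "poly ((mat [:0, 1:] - (\<chi> i j. [:M $ i $ j:])) $ i $ j) x = (x *\<^sub>R mat 1 - M) $ i $ j" for i j
    by (simp add: mat_def)
  then show ?thesis
    unfolding charpoly_def det_def
    by (simp add: poly_sum poly_prod)
qed

lemma poly_charpoly_eq_0_iff:
  "poly (charpoly M) x = 0 \<longleftrightarrow> (\<exists>w. w \<noteq> 0 \<and> M *v w = x *\<^sub>R w)"
proof -
  have "poly (charpoly M) x = 0 \<longleftrightarrow> (\<exists>w. w \<noteq> 0 \<and> (x *\<^sub>R mat 1 - M) *v w = 0)"
    unfolding poly_charpoly
    by (metis invertible_det_nz matrix_left_invertible_ker invertible_left_inverse)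
  also have "\<dots> \<longleftrightarrow> (\<exists>w. w \<noteq> 0 \<and> M *v w = x *\<^sub>R w)"
    by (auto simp: matrix_vector_mult_diff_rdistrib scaleR_matrix_vector_assoc[symmetric])
  finally show ?thesis .
qed

text \<open>If the second entry exceeded \<open>b\<close>, the two occurrences of \<open>a\<close>
  and \<open>b\<close> would have to share the head of the sorted list. Counting multiplicities
  covers \<open>a = b\<close> as well.\<close>

lemma second_smallest_le:
  fixes a b :: real
  assumes "{#a, b#} \<subseteq># X" "a \<le> b"
  shows "sorted_list_of_multiset X ! 1 \<le> b"
proof -
  let ?l = "sorted_list_of_multiset X"
  obtain Y where X: "X = add_mset a (add_mset b Y)"
    using assms(1) by (auto simp: mset_subset_eq_exists_conv)
  have "2 \<le> length ?l" by (simp add: X flip: size_mset)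
  then obtain x y r where l: "?l = x # y # r"
    by (metis Suc_le_length_iff numeral_2_eq_2)
  have s: "sorted (x # y # r)" using l sorted_sorted_list_of_multiset[of X] by simp
  have m: "mset (x # y # r) = add_mset a (add_mset b Y)" using l X by (metis mset_sorted_list_of_multiset)
  have "y \<le> b"
  proof (rule ccontr)
    assume "\<not> y \<le> b"
    with s assms have "a \<notin> set (y # r)" "b \<notin> set (y # r)" by auto
    then have "count (mset (y # r)) a = 0" "count (mset (y # r)) b = 0"
      by (auto simp: count_eq_zero_iff)
    moreover have "count (mset (x # y # r)) a = count (add_mset a (add_mset b Y)) a"
      "count (mset (x # y # r)) b = count (add_mset a (add_mset b Y)) b"
      using m by simp_all
    ultimately show False using \<open>a \<notin> set (y # r)\<close> \<open>b \<notin> set (y # r)\<close>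
      by (cases "a = b"; cases "x = a"; cases "x = b") auto
  qed
  then show ?thesis by (simp add: l)
qed

section \<open>The bipartite Laplacian and its spectral gap\<close>

lemma sum_UNIV_Plus:
  fixes f :: "'a::finite + 'b::finite \<Rightarrow> 'c::comm_monoid_add"
  shows "sum f UNIV = (\<Sum>i\<in>UNIV. f (Inl i)) + (\<Sum>j\<in>UNIV. f (Inr j))"
  by (simp add: UNIV_Plus_UNIV[symmetric] sum.Plus del: UNIV_Plus_UNIV)

lemma bipartite_laplacian_mult:
  fixes A :: "real^'m^'n" and y :: "real^('n + 'm)"
  shows "(bipartite_laplacian A *v y) $ Inl i = (\<Sum>j\<in>UNIV. A $ i $ j * (y $ Inl i - y $ Inr j))"
    and "(bipartite_laplacian A *v y) $ Inr j = (\<Sum>i\<in>UNIV. A $ i $ j * (y $ Inr j - y $ Inl i))"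
  by (simp_all add: matrix_vector_mult_def bipartite_laplacian_def sum_UNIV_Plus diag_mat_def
      if_distrib[of "\<lambda>x. x * _"] transpose_def sum_subtractf right_diff_distrib sum_distrib_right
      sum_negf cong: if_cong)

lemma inner_bipartite_laplacian:
  fixes A :: "real^'m^'n"
  shows "x \<bullet> (bipartite_laplacian A *v y) =
    (\<Sum>i\<in>UNIV. \<Sum>j\<in>UNIV. A $ i $ j * ((x $ Inl i - x $ Inr j) * (y $ Inl i - y $ Inr j)))"
proof -
  have "x \<bullet> (bipartite_laplacian A *v y) =
      (\<Sum>i\<in>UNIV. \<Sum>j\<in>UNIV. x $ Inl i * (A $ i $ j * (y $ Inl i - y $ Inr j)))
      + (\<Sum>j\<in>UNIV. \<Sum>i\<in>UNIV. x $ Inr j * (A $ i $ j * (y $ Inr j - y $ Inl i)))"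
    by (simp add: inner_vec_def sum_UNIV_Plus bipartite_laplacian_mult sum_distrib_left)
  also have "\<dots> = (\<Sum>i\<in>UNIV. \<Sum>j\<in>UNIV. x $ Inl i * (A $ i $ j * (y $ Inl i - y $ Inr j))
      + x $ Inr j * (A $ i $ j * (y $ Inr j - y $ Inl i)))"
    by (subst (2) sum.swap) (simp add: sum.distrib)
  finally show ?thesis by (simp add: algebra_simps)
qed

text \<open>The level set of \<open>f\<close> through \<open>a\<close> splits rows and columns with
  no nonzero entry across; if it missed \<open>b\<close>, the split would decompose
  \<open>A\<close>.\<close>

lemma indecomposable_constant:
  fixes A :: "real^'m^'n"
  assumes "indecomposable A" and eq: "\<And>i j. A $ i $ j \<noteq> 0 \<Longrightarrow> f (Inl i) = f (Inr j)"
  shows "f a = f b"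
proof (rule ccontr)
  assume ne: "f a \<noteq> f b"
  define N M where "N = {i. f (Inl i) = f a}" and "M = {j. f (Inr j) = f a}"
  have "(N, M) \<noteq> ({}, {})" by (cases a) (auto simp: N_def M_def)
  moreover have "(N, M) \<noteq> (UNIV, UNIV)"
    using ne by (cases b) (auto simp: N_def M_def set_eq_iff)
  moreover have "A $ i $ j = 0" if "(i \<in> N) \<noteq> (j \<in> M)" for i j
    using eq[of i j] that by (cases "A $ i $ j = 0") (auto simp: N_def M_def)
  ultimately have "decomposable A" unfolding decomposable_iff_partition by blast
  with assms show False by simp
qed

text \<open>Poincare inequality of the weighted bipartite graph, orthogonally to the constants.
  Columns and rows are kept as separate vectors, matching the arguments of \<open>g\<close>.\<close>

definition poincare :: "real^'m^'n \<Rightarrow> real \<Rightarrow> bool" where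
  "poincare A \<mu> \<longleftrightarrow> (\<forall>(x :: real^'m) (y :: real^'n). sum (($) x) UNIV + sum (($) y) UNIV = 0 \<longrightarrow>
     \<mu> * ((\<Sum>j\<in>UNIV. (x $ j)\<^sup>2) + (\<Sum>i\<in>UNIV. (y $ i)\<^sup>2))
       \<le> (\<Sum>i\<in>UNIV. \<Sum>j\<in>UNIV. A $ i $ j * (x $ j - y $ i)\<^sup>2))"

text \<open>\<open>\<mu>\<close> is the minimal Rayleigh quotient orthogonal to \<open>1\<close>. If
  it were 0, the minimizer would be constant by indecomposability, hence zero. So \<open>0\<close>
  and \<open>\<mu>\<close> are distinct eigenvalues, and the second entry of the sorted spectrum is
  at most \<open>\<mu>\<close>.\<close>

lemma bipartite_laplacian_spectral_gap:
  fixes A :: "real^'m^'n"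
  assumes A: "\<forall>i j. 0 \<le> A $ i $ j" and ind: "indecomposable A"
  obtains \<mu> where "0 < \<mu>" "second_smallest_eigenvalue (bipartite_laplacian A) \<le> \<mu>"
    "poincare A \<mu>"
proof -
  let ?L = "bipartite_laplacian A"
  let ?S = "{x :: real^('n + 'm). 1 \<bullet> x = 0}"
  have sym: "x \<bullet> (?L *v y) = (?L *v x) \<bullet> y" for x y
    unfolding inner_commute[of "?L *v x"] inner_bipartite_laplacian by (simp add: mult.commute)
  have L1: "?L *v 1 = 0"
  proof (subst vec_eq_iff, rule allI)
    show "(?L *v 1) $ a = 0 $ a" for a by (cases a) (auto simp: bipartite_laplacian_mult)
  qed
  have psd: "0 \<le> x \<bullet> (?L *v x)" for x
    unfolding inner_bipartite_laplacian using A
    by (intro sum_nonneg mult_nonneg_nonneg[OF _ zero_le_square]) auto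
  obtain i :: 'n and j :: 'm where True by simp
  have "axis (Inl i) 1 - axis (Inr j) 1 \<in> ?S"
    by (simp add: inner_diff_right inner_axis)
  moreover have "(axis (Inl i) 1 - axis (Inr j) 1 :: real^('n + 'm)) \<noteq> 0"
    by (simp add: axis_eq_axis)
  ultimately have ne: "?S \<noteq> {0}" by blast
  have inv: "?L *v x \<in> ?S" for x by (simp add: sym L1)
  obtain w \<mu> where "w \<in> ?S" and w: "w \<noteq> 0" "?L *v w = \<mu> *\<^sub>R w"
    and ray: "\<And>z. z \<in> ?S \<Longrightarrow> \<mu> * (z \<bullet> z) \<le> z \<bullet> (?L *v z)"
    by (rule rayleigh_minimizer_invariant_subspace[OF sym subspace_hyperplane ne inv]) blast
  have w1: "1 \<bullet> w = 0" using \<open>w \<in> ?S\<close> by simp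
  have \<mu>: "0 < \<mu>"
  proof (rule ccontr)
    assume "\<not> 0 < \<mu>"
    then have "w \<bullet> (?L *v w) \<le> 0" by (simp add: w(2) mult_nonpos_nonneg)
    with psd[of w] have "w \<bullet> (?L *v w) = 0" by simp
    then have "\<forall>i j. A $ i $ j * ((w $ Inl i - w $ Inr j) * (w $ Inl i - w $ Inr j)) = 0"
      unfolding inner_bipartite_laplacian using A
      by (simp add: sum_nonneg_eq_0_iff sum_nonneg)
    then have "w $ Inl i = w $ Inr j" if "A $ i $ j \<noteq> 0" for i j using that by auto
    then have const: "w $ a = w $ b" for a b
      by (rule indecomposable_constant[OF ind, where f = "($) w"])
    have "1 \<bullet> w = of_nat CARD('n + 'm) * w $ a" for a
    proof -
      have "(\<Sum>b\<in>UNIV. w $ b) = (\<Sum>b\<in>(UNIV :: ('n + 'm) set). w $ a)"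
        by (rule sum.cong[OF refl const])
      then show ?thesis by (simp add: inner_vec_def del: card_sum)
    qed
    with w1 have "w = 0" by (simp add: vec_eq_iff add_nonneg_eq_0_iff)
    with w(1) show False ..
  qed
  \<comment> \<open>Membership in \<open>proots\<close> means being a root only for a nonzero
    polynomial; by positive semidefiniteness \<open>- 1\<close> is not a root.\<close>
  have "poly (charpoly ?L) (- 1) \<noteq> 0"
  proof
    assume "poly (charpoly ?L) (- 1) = 0"
    then obtain z where z: "z \<noteq> 0" "?L *v z = - 1 *\<^sub>R z" by (auto simp: poly_charpoly_eq_0_iff)
    with psd[of z] have "z \<bullet> z \<le> 0" by simp
    with z(1) show False by (metis inner_gt_zero_iff not_le)
  qed
  then have nz: "charpoly ?L \<noteq> 0" by auto
  have "\<exists>x. x \<noteq> 0 \<and> ?L *v x = 0 *\<^sub>R x" by (rule exI[of _ 1]) (simp add: L1 vec_eq_iff)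
  then have "poly (charpoly ?L) 0 = 0" "poly (charpoly ?L) \<mu> = 0"
    unfolding poly_charpoly_eq_0_iff using w by blast+
  then have "0 \<in># proots (charpoly ?L)" "\<mu> \<in># proots (charpoly ?L)"
    using nz by simp_all
  then have "{#0, \<mu>#} \<subseteq># proots (charpoly ?L)"
    using \<mu> by (intro mset_subset_eqI) (auto simp: Suc_le_eq)
  then have "second_smallest_eigenvalue ?L \<le> \<mu>"
    unfolding second_smallest_eigenvalue_def eigenvalues_mset_def
    using \<mu> by (intro second_smallest_le[of 0]) auto
  moreover have "\<mu> * ((\<Sum>j\<in>UNIV. (x $ j)\<^sup>2) + (\<Sum>i\<in>UNIV. (y $ i)\<^sup>2))
        \<le> (\<Sum>i\<in>UNIV. \<Sum>j\<in>UNIV. A $ i $ j * (x $ j - y $ i)\<^sup>2)"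
    if "sum (($) x) UNIV + sum (($) y) UNIV = 0" for x :: "real^'m" and y :: "real^'n"
  proof -
    define z :: "real^('n + 'm)" where "z = (\<chi> a. case a of Inl i \<Rightarrow> y $ i | Inr j \<Rightarrow> x $ j)"
    have "z \<in> ?S" using that by (simp add: inner_vec_def sum_UNIV_Plus z_def)
    from ray[OF this] show ?thesis
      unfolding inner_bipartite_laplacian
      by (simp add: inner_vec_def sum_UNIV_Plus z_def power2_eq_square algebra_simps)
  qed
  ultimately show thesis using that \<mu> unfolding poincare_def by blast
qed

section \<open>Linear growth and translations\<close>

text \<open>For \<open>x \<ge> 0\<close>, compare with the tangent of \<open>a * exp x\<close> at
  \<open>ln (2 * b / a)\<close>: its slope is \<open>2 * b\<close>, half of which survives
  subtracting \<open>b * x\<close>. For \<open>x < 0\<close>, the term \<open>- b * x\<close> is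
  already \<open>b * \<bar>x\<bar>\<close>.\<close>

lemma linear_lower_bound:
  fixes a b x :: real
  assumes "0 < a" "0 < b"
  shows "b * \<bar>x\<bar> - 2 * b * \<bar>ln (2 * b / a)\<bar> \<le> a * exp x - b * x"
proof (cases "0 \<le> x")
  case True
  let ?s = "ln (2 * b / a)"
  have "2 * b * (1 + (x - ?s)) \<le> 2 * b * exp (x - ?s)"
    using assms by (intro mult_left_mono exp_ge_add_one_self) auto
  also have "\<dots> = a * exp x" using assms by (simp add: exp_diff)
  finally have "2 * b * (1 + (x - ?s)) \<le> a * exp x" .
  moreover have "2 * b * (x - \<bar>?s\<bar>) \<le> 2 * b * (1 + (x - ?s))"
    using assms by (intro mult_left_mono) auto
  ultimately show ?thesis using True by (simp add: algebra_simps)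
next
  case False
  have "0 \<le> a * exp x" "0 \<le> b * \<bar>ln (2 * b / a)\<bar>" using assms by auto
  then show ?thesis using False by (simp add: algebra_simps)
qed

definition shift :: "real \<Rightarrow> real^'k \<Rightarrow> real^'k" where
  "shift s x = (\<chi> i. x $ i + s)"

lemma shift_nth [simp]: "shift s x $ i = x $ i + s"
  by (simp add: shift_def)

lemma sum_shift: "sum (($) (shift s x)) UNIV = sum (($) x) UNIV + real CARD('k) * s"
  for x :: "real^'k"
  by (simp add: sum.distrib)

lemma exists_shift:
  fixes u :: "real^'m" and v :: "real^'n"
  obtains s where "sum (($) (shift s u)) UNIV + sum (($) (shift s v)) UNIV = a"
proof
  let ?N = "real CARD('m) + real CARD('n)"
  let ?s = "(a - sum (($) u) UNIV - sum (($) v) UNIV) / ?N"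
  have "?N \<noteq> 0" by (simp add: add_nonneg_eq_0_iff)
  then have "?N * ?s = a - sum (($) u) UNIV - sum (($) v) UNIV" by simp
  moreover have "sum (($) (shift ?s u)) UNIV + sum (($) (shift ?s v)) UNIV
      = sum (($) u) UNIV + sum (($) v) UNIV + ?N * ?s"
    by (simp only: sum_shift distrib_right)
  ultimately show "sum (($) (shift ?s u)) UNIV + sum (($) (shift ?s v)) UNIV = a" by simp
qed

section \<open>The objective in terms of the scaled matrix\<close>

locale scaling_problem =
  fixes A :: "real^'m^'n" and p :: "real^'n" and q :: "real^'m"
  assumes A_nonneg: "\<And>i j. 0 \<le> A $ i $ j"
    and p_pos: "\<And>i. 0 < p $ i" and q_pos: "\<And>j. 0 < q $ j"
    and sum_eq: "sum (($) p) UNIV = sum (($) q) UNIV"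
    and existence: "strong_existence A p q"
    and indec: "indecomposable A"
begin

abbreviation g where "g \<equiv> sinkhorn_g A p q"

abbreviation g_star where "g_star \<equiv> sinkhorn_g_star A p q"

text \<open>The marginals of this matrix carry the gradient of \<open>g\<close>: it is
  \<open>col_sum u v j - q $ j\<close> in \<open>u $ j\<close> and
  \<open>p $ i - row_sum u v i\<close> in \<open>v $ i\<close>.\<close>

definition scaled :: "real^'m \<Rightarrow> real^'n \<Rightarrow> 'n \<Rightarrow> 'm \<Rightarrow> real" where
  "scaled u v i j = A $ i $ j * exp (u $ j - v $ i)"

definition row_sum :: "real^'m \<Rightarrow> real^'n \<Rightarrow> 'n \<Rightarrow> real" where
  "row_sum u v i = (\<Sum>j\<in>UNIV. scaled u v i j)"

definition col_sum :: "real^'m \<Rightarrow> real^'n \<Rightarrow> 'm \<Rightarrow> real" where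
  "col_sum u v j = (\<Sum>i\<in>UNIV. scaled u v i j)"

lemma g_eq_scaled:
  "g u v = (\<Sum>i\<in>UNIV. \<Sum>j\<in>UNIV. scaled u v i j)
    + (\<Sum>i\<in>UNIV. p $ i * v $ i) - (\<Sum>j\<in>UNIV. q $ j * u $ j)"
  by (simp add: sinkhorn_g_def scaled_def)

lemma g_eq_row_sum:
  "g u v = (\<Sum>i\<in>UNIV. row_sum u v i) + (\<Sum>i\<in>UNIV. p $ i * v $ i) - (\<Sum>j\<in>UNIV. q $ j * u $ j)"
  by (simp add: g_eq_scaled row_sum_def)

lemma g_eq_col_sum:
  "g u v = (\<Sum>j\<in>UNIV. col_sum u v j) + (\<Sum>i\<in>UNIV. p $ i * v $ i) - (\<Sum>j\<in>UNIV. q $ j * u $ j)"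
  unfolding g_eq_scaled col_sum_def by (subst sum.swap) simp

lemma transport_plan:
  obtains A' :: "real^'m^'n" where "\<And>i j. 0 \<le> A' $ i $ j" "\<And>i j. A' $ i $ j = 0 \<longleftrightarrow> A $ i $ j = 0"
    "\<And>i. p $ i = (\<Sum>j\<in>UNIV. A' $ i $ j)" "\<And>j. q $ j = (\<Sum>i\<in>UNIV. A' $ i $ j)"
proof -
  obtain A' :: "real^'m^'n" where A': "\<And>i j. 0 \<le> A' $ i $ j" "\<And>i j. A' $ i $ j = 0 \<longleftrightarrow> A $ i $ j = 0"
    and p: "p = A' *v 1" and q: "q = transpose A' *v 1"
    using existence unfolding strong_existence_def by blast
  have "p $ i = (\<Sum>j\<in>UNIV. A' $ i $ j)" "q $ j = (\<Sum>i\<in>UNIV. A' $ i $ j)" for i j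
    by (simp_all add: p q matrix_vector_mult_def transpose_def)
  then show thesis using that A' by blast
qed

lemma row_nonzero: "\<exists>j. 0 < A $ i $ j"
proof -
  obtain A' :: "real^'m^'n" where "\<And>i j. A' $ i $ j = 0 \<longleftrightarrow> A $ i $ j = 0"
    "\<And>i. p $ i = (\<Sum>j\<in>UNIV. A' $ i $ j)" using transport_plan by metis
  then have "\<exists>j. A $ i $ j \<noteq> 0" using p_pos[of i] by (metis less_irrefl sum.neutral)
  then show ?thesis using A_nonneg by (metis order_less_le)
qed

lemma col_nonzero: "\<exists>i. 0 < A $ i $ j"
proof -
  obtain A' :: "real^'m^'n" where "\<And>i j. A' $ i $ j = 0 \<longleftrightarrow> A $ i $ j = 0"
    "\<And>j. q $ j = (\<Sum>i\<in>UNIV. A' $ i $ j)" using transport_plan by metis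
  then have "\<exists>i. A $ i $ j \<noteq> 0" using q_pos[of j] by (metis less_irrefl sum.neutral)
  then show ?thesis using A_nonneg by (metis order_less_le)
qed

lemma scaled_nonneg: "0 \<le> scaled u v i j"
  by (simp add: scaled_def A_nonneg)

lemma row_sum_pos: "0 < row_sum u v i"
proof -
  obtain j where "0 < A $ i $ j" using row_nonzero by blast
  then show ?thesis
    unfolding row_sum_def
    by (intro sum_pos2[of UNIV j]) (auto simp: scaled_nonneg, simp add: scaled_def)
qed

lemma col_sum_pos: "0 < col_sum u v j"
proof -
  obtain i where "0 < A $ i $ j" using col_nonzero by blast
  then show ?thesis
    unfolding col_sum_def
    by (intro sum_pos2[of UNIV i]) (auto simp: scaled_nonneg, simp add: scaled_def)
qed

text \<open>The exponents contain only differences \<open>u $ j - v $ i\<close>, and the changes of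
  the linear terms cancel because \<open>p\<close> and \<open>q\<close> have equal totals.\<close>

lemma g_shift: "g (shift s u) (shift s v) = g u v"
  using sum_eq by (simp add: g_eq_scaled scaled_def distrib_left sum.distrib flip: sum_distrib_right)

text \<open>Along an edge \<open>A $ i $ j > 0\<close>, \<open>g\<close> grows at least linearly in \<open>\<bar>u $ j - v $ i\<bar>\<close>, with slope
  the entry of the matrix \<open>A'\<close> of (Strong Existence).\<close>

lemma edge_differences_bounded:
  obtains D :: "'n \<Rightarrow> 'm \<Rightarrow> real"
  where "\<And>u v i j. g u v \<le> C \<Longrightarrow> A $ i $ j \<noteq> 0 \<Longrightarrow> \<bar>u $ j - v $ i\<bar> \<le> D i j"
proof -
  obtain A' :: "real^'m^'n" where nn: "\<And>i j. 0 \<le> A' $ i $ j"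
    and zp: "\<And>i j. A' $ i $ j = 0 \<longleftrightarrow> A $ i $ j = 0"
    and p: "\<And>i. p $ i = (\<Sum>j\<in>UNIV. A' $ i $ j)" and q: "\<And>j. q $ j = (\<Sum>i\<in>UNIV. A' $ i $ j)"
    using transport_plan by blast
  define k where "k i j = 2 * A' $ i $ j * \<bar>ln (2 * A' $ i $ j / A $ i $ j)\<bar>" for i j
  define K where "K = C + (\<Sum>i\<in>UNIV. \<Sum>j\<in>UNIV. k i j)"
  have "\<bar>u $ j - v $ i\<bar> \<le> K / A' $ i $ j" if le: "g u v \<le> C" and ij: "A $ i $ j \<noteq> 0" for u v i j
  proof -
    let ?f = "\<lambda>i j. A' $ i $ j * \<bar>u $ j - v $ i\<bar>"
    have "?f i j - k i j \<le> A $ i $ j * exp (u $ j - v $ i) - A' $ i $ j * (u $ j - v $ i)" for i j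
    proof (cases "A $ i $ j = 0")
      case True
      then show ?thesis using zp[of i j] by (simp add: k_def)
    next
      case False
      then have "0 < A $ i $ j" "0 < A' $ i $ j" using A_nonneg nn zp by (metis order_less_le)+
      then show ?thesis unfolding k_def by (rule linear_lower_bound)
    qed
    then have "(\<Sum>i\<in>UNIV. \<Sum>j\<in>UNIV. ?f i j - k i j) \<le> (\<Sum>i\<in>UNIV. \<Sum>j\<in>UNIV.
        A $ i $ j * exp (u $ j - v $ i) - A' $ i $ j * (u $ j - v $ i))"
      by (intro sum_mono)
    \<comment> \<open>Since \<open>p\<close> and \<open>q\<close> are the marginals of
      \<open>A'\<close>, the linear terms of \<open>g\<close> are also a sum over entries.\<close>
    also have "\<dots> = g u v"
    proof -
      have "(\<Sum>j\<in>UNIV. q $ j * u $ j) = (\<Sum>i\<in>UNIV. \<Sum>j\<in>UNIV. A' $ i $ j * u $ j)"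
        unfolding q by (subst sum.swap) (simp add: sum_distrib_right)
      moreover have "(\<Sum>i\<in>UNIV. p $ i * v $ i) = (\<Sum>i\<in>UNIV. \<Sum>j\<in>UNIV. A' $ i $ j * v $ i)"
        unfolding p by (simp add: sum_distrib_right)
      ultimately show ?thesis
        by (simp add: g_eq_scaled scaled_def sum.distrib sum_subtractf right_diff_distrib)
    qed
    finally have "(\<Sum>i\<in>UNIV. \<Sum>j\<in>UNIV. ?f i j) \<le> K"
      using le by (simp add: K_def sum_subtractf)
    moreover have "?f i j \<le> (\<Sum>j\<in>UNIV. ?f i j)"
      by (rule member_le_sum) (auto simp: nn)
    moreover have "(\<Sum>j\<in>UNIV. ?f i j) \<le> (\<Sum>i\<in>UNIV. \<Sum>j\<in>UNIV. ?f i j)"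
      by (rule member_le_sum[where f = "\<lambda>i. \<Sum>j\<in>UNIV. ?f i j"]) (auto simp: nn intro!: sum_nonneg)
    ultimately have "?f i j \<le> K" by linarith
    moreover have "0 < A' $ i $ j" using ij nn zp by (metis order_less_le)
    ultimately show ?thesis by (simp add: field_simps)
  qed
  then show thesis by (rule that)
qed

section \<open>Boundedness of the normalized level set\<close>

text \<open>The Poincare inequality turns the bounds on edge differences into a bound on the
  Euclidean norm of pairs with vanishing total, which dominates the maximum norm.\<close>

lemma sinkhorn_B_finite: "sinkhorn_B A p q u0 v0 < \<infinity>"
proof -
  obtain D where D: "\<And>u v i j. g u v \<le> g u0 v0 \<Longrightarrow> A $ i $ j \<noteq> 0 \<Longrightarrow> \<bar>u $ j - v $ i\<bar> \<le> D i j"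
    using edge_differences_bounded by metis
  obtain \<mu> where \<mu>: "0 < \<mu>" and gap: "poincare A \<mu>"
    using bipartite_laplacian_spectral_gap[of A] A_nonneg indec by metis
  define R where "R = (\<Sum>i\<in>UNIV. \<Sum>j\<in>UNIV. A $ i $ j * (D i j)\<^sup>2) / \<mu>"
  have "infnorm (u, v) \<le> sqrt R" if "(u, v) \<bullet> (1, 1) = 0" and le: "g u v \<le> g u0 v0" for u v
  proof -
    have "sum (($) u) UNIV + sum (($) v) UNIV = 0" using that by (simp add: inner_vec_def)
    note gap[unfolded poincare_def, rule_format, OF this]
    also have "(\<Sum>i\<in>UNIV. \<Sum>j\<in>UNIV. A $ i $ j * (u $ j - v $ i)\<^sup>2) \<le> \<mu> * R"
    proof -
      have "A $ i $ j * (u $ j - v $ i)\<^sup>2 \<le> A $ i $ j * (D i j)\<^sup>2" for i j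
      proof (cases "A $ i $ j = 0")
        case False
        from D[OF le this] show ?thesis
          by (intro mult_left_mono A_nonneg abs_le_square_iff[THEN iffD1]) auto
      qed simp
      then show ?thesis using \<mu> by (simp add: R_def sum_mono)
    qed
    finally have "(u \<bullet> u) + (v \<bullet> v) \<le> R" using \<mu> by (simp add: inner_vec_def power2_eq_square)
    moreover have "infnorm (u, v) \<le> sqrt ((u \<bullet> u) + (v \<bullet> v))"
      using infnorm_le_norm[of "(u, v)"] by (simp add: norm_Pair power2_norm_eq_inner)
    ultimately show ?thesis by (meson order_trans real_sqrt_le_iff)
  qed
  then have "sinkhorn_B A p q u0 v0 \<le> ereal (sqrt R)"
    unfolding sinkhorn_B_def by (intro Sup_least) auto
  then show ?thesis by (rule le_less_trans) simp
qed

text \<open>A common shift makes the total vanish without changing \<open>g\<close> or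
  \<open>u $ j - v $ i\<close>; then both coordinates are bounded by \<open>B\<close>, whence the
  factor 2.\<close>

lemma level_set_bound:
  assumes "g u v \<le> g u0 v0"
  shows "\<bar>u $ j - v $ i\<bar> \<le> 2 * real_of_ereal (sinkhorn_B A p q u0 v0)"
proof -
  let ?B = "sinkhorn_B A p q u0 v0"
  obtain s where s: "sum (($) (shift s u)) UNIV + sum (($) (shift s v)) UNIV = 0"
    using exists_shift by blast
  let ?u = "shift s u" and ?v = "shift s v"
  have "ereal (infnorm (?u, ?v)) \<le> ?B"
    unfolding sinkhorn_B_def
    by (rule Sup_upper) (use s assms in \<open>auto simp: inner_vec_def g_shift intro!: exI[of _ ?u] exI[of _ ?v]\<close>)
  \<comment> \<open>Finiteness matters here, as \<open>real_of_ereal\<close> sends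
    \<open>\<infinity>\<close> to 0.\<close>
  with sinkhorn_B_finite[of u0 v0] have B: "infnorm (?u, ?v) \<le> real_of_ereal ?B"
    by (cases ?B) auto
  have "\<bar>(?u, ?v) \<bullet> (axis j 1, 0)\<bar> \<le> infnorm (?u, ?v)" "\<bar>(?u, ?v) \<bullet> (0, axis i 1)\<bar> \<le> infnorm (?u, ?v)"
    by (rule Basis_le_infnorm; simp add: Basis_prod_def axis_in_Basis_iff)+
  then have "\<bar>?u $ j\<bar> \<le> infnorm (?u, ?v)" "\<bar>?v $ i\<bar> \<le> infnorm (?u, ?v)"
    by (simp_all add: inner_axis)
  with B show ?thesis by simp
qed

section \<open>The infimum and the gradient bound\<close>

lemma g_star_le: "g_star \<le> g u v"
proof -
  have "(INF x\<in>UNIV. case x of (u, v) \<Rightarrow> g u v) \<le> (case (u, v) of (u, v) \<Rightarrow> g u v)"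
    by (intro cINF_lower sinkhorn_g_bdd_below) (auto simp: A_nonneg existence)
  then show ?thesis by (simp add: sinkhorn_g_star_def)
qed

lemma le_g_star: "c \<le> g_star" if "\<And>u v. c \<le> g u v"
  unfolding sinkhorn_g_star_def by (rule cINF_greatest) (auto simp: that)

text \<open>Strong convexity transverse to the shifts, followed by minimization of the quadratic
  lower bound. The sums of squares are the squared gradient at \<open>(u, v)\<close>, so letting
  \<open>(u', v')\<close> vary yields a Polyak-Lojasiewicz inequality.\<close>

lemma g_minus_le:
  fixes u u' :: "real^'m" and v v' :: "real^'n"
  assumes b: "\<And>i j. - b \<le> u $ j - v $ i" "\<And>i j. - b \<le> u' $ j - v' $ i"
    and \<mu>: "0 < \<mu>" and gap: "poincare A \<mu>"
  shows "g u v - g u' v' \<le> ((\<Sum>j\<in>UNIV. (col_sum u v j - q $ j)\<^sup>2)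
      + (\<Sum>i\<in>UNIV. (row_sum u v i - p $ i)\<^sup>2)) / (2 * (exp (- b) * \<mu>))"
proof -
  \<comment> \<open>This shift makes the displacement \<open>(x, y)\<close> orthogonal to the
    constants, as the Poincare inequality requires.\<close>
  obtain s where s: "sum (($) (shift s u')) UNIV + sum (($) (shift s v')) UNIV
      = sum (($) u) UNIV + sum (($) v) UNIV"
    using exists_shift by blast
  define x y where "x = shift s u' - u" and "y = shift s v' - v"
  define \<sigma> where "\<sigma> = exp (- b) * \<mu>"
  have \<sigma>: "0 < \<sigma>" using \<mu> by (simp add: \<sigma>_def)
  have xy: "sum (($) x) UNIV + sum (($) y) UNIV = 0"
    using s by (simp add: x_def y_def sum_subtractf)
  let ?S = "\<lambda>f. \<Sum>i\<in>UNIV. \<Sum>j\<in>UNIV. f i j :: real"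
  have "scaled u v i j + scaled u v i j * (x $ j - y $ i)
      + exp (- b) / 2 * (A $ i $ j * (x $ j - y $ i)\<^sup>2) \<le> scaled u' v' i j" for i j
    using mult_left_mono[OF exp_ge_second_order[OF b(1)[of j i] b(2)[of j i]] A_nonneg[of i j]]
    by (simp add: scaled_def x_def y_def algebra_simps)
  then have "?S (\<lambda>i j. scaled u v i j + scaled u v i j * (x $ j - y $ i)
      + exp (- b) / 2 * (A $ i $ j * (x $ j - y $ i)\<^sup>2)) \<le> ?S (scaled u' v')"
    by (intro sum_mono)
  then have 1: "?S (scaled u v) + ?S (\<lambda>i j. scaled u v i j * (x $ j - y $ i))
      + exp (- b) / 2 * ?S (\<lambda>i j. A $ i $ j * (x $ j - y $ i)\<^sup>2) \<le> ?S (scaled u' v')"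
    by (simp add: sum.distrib sum_distrib_left)
  have 2: "\<sigma> / 2 * ((\<Sum>j\<in>UNIV. (x $ j)\<^sup>2) + (\<Sum>i\<in>UNIV. (y $ i)\<^sup>2))
      \<le> exp (- b) / 2 * ?S (\<lambda>i j. A $ i $ j * (x $ j - y $ i)\<^sup>2)"
    using mult_left_mono[OF gap[unfolded poincare_def, rule_format, OF xy], of "exp (- b) / 2"] by (simp add: \<sigma>_def mult_ac)
  have 3: "?S (\<lambda>i j. scaled u v i j * (x $ j - y $ i))
      = (\<Sum>j\<in>UNIV. col_sum u v j * x $ j) - (\<Sum>i\<in>UNIV. row_sum u v i * y $ i)"
  proof -
    have "?S (\<lambda>i j. scaled u v i j * x $ j) = (\<Sum>j\<in>UNIV. col_sum u v j * x $ j)"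
      by (subst sum.swap) (simp add: col_sum_def sum_distrib_right)
    then show ?thesis by (simp add: row_sum_def right_diff_distrib sum_subtractf sum_distrib_right)
  qed
  have 4: "g u' v' - g u v = ?S (scaled u' v') - ?S (scaled u v)
      + (\<Sum>i\<in>UNIV. p $ i * y $ i) - (\<Sum>j\<in>UNIV. q $ j * x $ j)"
    unfolding g_shift[of s u' v', symmetric]
    by (simp add: g_eq_scaled x_def y_def scaled_def right_diff_distrib sum_subtractf)
  \<comment> \<open>Completing the square; \<open>a\<close> stands for a gradient component and
    \<open>z\<close> for a displacement.\<close>
  have sq: "- (a * z) - \<sigma> / 2 * z\<^sup>2 \<le> a\<^sup>2 / (2 * \<sigma>)" for a z
    using \<sigma> zero_le_power2[of "a + \<sigma> * z"] by (simp add: field_simps power2_eq_square)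
  have "(\<Sum>j\<in>UNIV. - ((col_sum u v j - q $ j) * x $ j) - \<sigma> / 2 * (x $ j)\<^sup>2)
      + (\<Sum>i\<in>UNIV. - ((p $ i - row_sum u v i) * y $ i) - \<sigma> / 2 * (y $ i)\<^sup>2)
    \<le> (\<Sum>j\<in>UNIV. (col_sum u v j - q $ j)\<^sup>2 / (2 * \<sigma>)) + (\<Sum>i\<in>UNIV. (p $ i - row_sum u v i)\<^sup>2 / (2 * \<sigma>))"
    by (intro add_mono sum_mono sq)
  also have "\<dots> = ((\<Sum>j\<in>UNIV. (col_sum u v j - q $ j)\<^sup>2)
      + (\<Sum>i\<in>UNIV. (row_sum u v i - p $ i)\<^sup>2)) / (2 * \<sigma>)"
    by (simp add: add_divide_distrib sum_divide_distrib power2_commute)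
  finally have "(\<Sum>j\<in>UNIV. q $ j * x $ j) - (\<Sum>j\<in>UNIV. col_sum u v j * x $ j)
      - \<sigma> / 2 * (\<Sum>j\<in>UNIV. (x $ j)\<^sup>2)
      + ((\<Sum>i\<in>UNIV. row_sum u v i * y $ i) - (\<Sum>i\<in>UNIV. p $ i * y $ i)
      - \<sigma> / 2 * (\<Sum>i\<in>UNIV. (y $ i)\<^sup>2))
    \<le> ((\<Sum>j\<in>UNIV. (col_sum u v j - q $ j)\<^sup>2)
      + (\<Sum>i\<in>UNIV. (row_sum u v i - p $ i)\<^sup>2)) / (2 * \<sigma>)"
    by (simp only: sum_subtractf left_diff_distrib sum_negf sum_distrib_left minus_diff_eq)
  with 1 2 4 show ?thesis unfolding 3 distrib_left \<sigma>_def[symmetric] by linarith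
qed

section \<open>Decrease of the objective in a half step\<close>

text \<open>Optimality of \<open>u'\<close> gives
  \<open>u $ j - u' $ j = ln (col_sum u v j / q $ j)\<close>, so the decrease is exactly a sum of
  Kullback-Leibler terms.\<close>

lemma g_decrease_column_update:
  assumes opt: "\<And>j. col_sum u' v j = q $ j"
    and M: "\<And>j. col_sum u v j \<le> M" "\<And>j. q $ j \<le> M"
  shows "(\<Sum>j\<in>UNIV. (col_sum u v j - q $ j)\<^sup>2) / (2 * M) \<le> g u v - g u' v"
proof -
  have r: "col_sum u v j = q $ j * exp (u $ j - u' $ j)" for j
    unfolding opt[symmetric] col_sum_def
    by (simp add: scaled_def sum_distrib_right mult.assoc flip: exp_add)
  have ln: "ln (col_sum u v j / q $ j) = u $ j - u' $ j" for j
    using q_pos[of j] by (simp add: r)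
  have "(\<Sum>j\<in>UNIV. (col_sum u v j - q $ j)\<^sup>2) / (2 * M)
      \<le> (\<Sum>j\<in>UNIV. col_sum u v j - q $ j - q $ j * ln (col_sum u v j / q $ j))"
    unfolding sum_divide_distrib
    by (intro sum_mono entropy_gap_ge_square col_sum_pos q_pos M)
  then show ?thesis
    by (simp add: ln g_eq_col_sum opt sum_subtractf right_diff_distrib)
qed

lemma g_decrease_row_update:
  assumes opt: "\<And>i. row_sum u v' i = p $ i"
    and M: "\<And>i. row_sum u v i \<le> M" "\<And>i. p $ i \<le> M"
  shows "(\<Sum>i\<in>UNIV. (row_sum u v i - p $ i)\<^sup>2) / (2 * M) \<le> g u v - g u v'"
proof -
  have r: "row_sum u v i = p $ i * exp (v' $ i - v $ i)" for i
    unfolding opt[symmetric] row_sum_def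
    by (simp add: scaled_def sum_distrib_right mult.assoc flip: exp_add)
  have ln: "ln (row_sum u v i / p $ i) = v' $ i - v $ i" for i
    using p_pos[of i] by (simp add: r)
  have "(\<Sum>i\<in>UNIV. (row_sum u v i - p $ i)\<^sup>2) / (2 * M)
      \<le> (\<Sum>i\<in>UNIV. row_sum u v i - p $ i - p $ i * ln (row_sum u v i / p $ i))"
    unfolding sum_divide_distrib
    by (intro sum_mono entropy_gap_ge_square row_sum_pos p_pos M)
  then show ?thesis
    by (simp add: ln g_eq_row_sum opt sum_subtractf right_diff_distrib)
qed

lemma col_sum_le:
  assumes "\<And>i j. u $ j - v $ i \<le> b"
  shows "col_sum u v j \<le> exp b * (transpose A *v 1) $ j"
proof -
  have "col_sum u v j \<le> (\<Sum>i\<in>UNIV. A $ i $ j * exp b)"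
    unfolding col_sum_def scaled_def using assms by (intro sum_mono mult_left_mono A_nonneg) auto
  then show ?thesis by (simp add: matrix_vector_mult_def transpose_def sum_distrib_left mult.commute)
qed

lemma row_sum_le:
  assumes "\<And>i j. u $ j - v $ i \<le> b"
  shows "row_sum u v i \<le> exp b * (A *v 1) $ i"
proof -
  have "row_sum u v i \<le> (\<Sum>j\<in>UNIV. A $ i $ j * exp b)"
    unfolding row_sum_def scaled_def using assms by (intro sum_mono mult_left_mono A_nonneg) auto
  then show ?thesis by (simp add: matrix_vector_mult_def sum_distrib_left mult.commute)
qed

text \<open>With \<open>B \<ge> 0\<close> this keeps \<open>1 - exp (- 4 * B) * (\<mu> / l1)\<close>
  nonnegative when \<open>l1 < l0\<close>. The test pair is zero on columns and a difference of two
  unit vectors on rows: squared norm 2, Dirichlet form the sum of two row sums.\<close>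

lemma gap_le_max_row_sum:
  assumes gap: "poincare A \<mu>"
    and l1: "\<And>i. (A *v 1) $ i \<le> l1"
    and lt: "l1 < Max (range (\<lambda>j. (transpose A *v 1) $ j))"
  shows "\<mu> \<le> l1"
proof -
  \<comment> \<open>There are two rows: the row sum of a one-row matrix is at least every column sum.\<close>
  have "\<exists>i i' :: 'n. i \<noteq> i'"
  proof (rule ccontr)
    assume "\<not> ?thesis"
    then have one: "(UNIV :: 'n set) = {i}" for i by auto
    have "(transpose A *v 1) $ j \<le> l1" for j
    proof -
      obtain i :: 'n where True by simp
      have "(transpose A *v 1) $ j = A $ i $ j"
        by (simp add: matrix_vector_mult_def transpose_def one[of i])
      also have "\<dots> \<le> (A *v 1) $ i"
        unfolding matrix_vector_mult_def
        using member_le_sum[of j UNIV "\<lambda>j. A $ i $ j"] by (simp add: A_nonneg)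
      finally show ?thesis using l1[of i] by linarith
    qed
    with lt show False by (auto simp: less_le_not_le)
  qed
  then obtain i i' :: 'n where ne: "i \<noteq> i'" by blast
  define y :: "real^'n" where "y = axis i 1 - axis i' 1"
  have y: "y $ k = (if k = i then 1 else 0) - (if k = i' then 1 else 0)" for k
    by (simp add: y_def axis_def)
  have sum_y: "sum (($) y) UNIV = 0" by (simp add: y sum_subtractf)
  have y2: "(y $ k)\<^sup>2 = (if k = i then 1 else 0) + (if k = i' then 1 else 0)" for k
    using ne by (simp add: y)
  have "\<mu> * (\<Sum>k\<in>UNIV. (y $ k)\<^sup>2) \<le> (\<Sum>k\<in>UNIV. \<Sum>j\<in>UNIV. A $ k $ j * (y $ k)\<^sup>2)"
    using gap[unfolded poincare_def, rule_format, of 0 y] by (simp add: sum_y)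
  also have "\<dots> = (\<Sum>k\<in>UNIV. (A *v 1) $ k * (y $ k)\<^sup>2)"
    by (simp add: matrix_vector_mult_def sum_distrib_right)
  also have "\<dots> = (A *v 1) $ i + (A *v 1) $ i'"
    by (simp add: y2 distrib_left sum.distrib if_distrib[of "(*) _"] cong: if_cong)
  finally show ?thesis using l1[of i] l1[of i'] by (simp add: y2 sum.distrib)
qed

section \<open>One iteration of the algorithm\<close>

lemma row_sum_optimal:
  assumes "v $ i = - ln (p $ i / (\<Sum>j\<in>UNIV. A $ i $ j * exp (u $ j)))"
  shows "row_sum u v i = p $ i"
proof -
  let ?r = "\<Sum>j\<in>UNIV. A $ i $ j * exp (u $ j)"
  have eq: "row_sum u v i = ?r * exp (- v $ i)" for v
    by (simp add: row_sum_def scaled_def exp_diff exp_minus sum_distrib_right divide_inverse mult.assoc)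
  have "0 < ?r" using eq[of 0] row_sum_pos[of u 0 i] by simp
  then show ?thesis unfolding eq using assms p_pos[of i] by simp
qed

lemma col_sum_optimal:
  assumes "u $ j = ln (q $ j / (\<Sum>i\<in>UNIV. A $ i $ j * exp (- v $ i)))"
  shows "col_sum u v j = q $ j"
proof -
  let ?c = "\<Sum>i\<in>UNIV. A $ i $ j * exp (- v $ i)"
  have eq: "col_sum u v j = ?c * exp (u $ j)" for u
    by (simp add: col_sum_def scaled_def exp_diff exp_minus sum_distrib_left divide_inverse mult_ac)
  have "0 < ?c" using eq[of 0] col_sum_pos[of 0 v j] by simp
  then show ?thesis unfolding eq using assms q_pos[of j] by simp
qed

text \<open>The iteration passes from \<open>(u, v)\<close> through \<open>(u', v)\<close> to
  \<open>(u', v')\<close>. The column update gives the rate with \<open>l0\<close>, the row update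
  the rate with \<open>l1\<close>; in each case the other half step enters only through monotonicity
  of \<open>g\<close>.\<close>

lemma sinkhorn_contraction:
  assumes opt: "\<And>i. row_sum u v i = p $ i" "\<And>j. col_sum u' v j = q $ j"
      "\<And>i. row_sum u' v' i = p $ i"
    and le: "g u v \<le> g u0 v0" "g u' v \<le> g u0 v0" "g u' v' \<le> g u' v"
    and B: "B = real_of_ereal (sinkhorn_B A p q u0 v0)"
    and l0: "l0 = Max (range (\<lambda>j. (transpose A *v 1) $ j))"
    and l1: "l1 = Max (range (\<lambda>i. (A *v 1) $ i))"
  shows "g u' v' - g_star
    \<le> (1 - exp (- 4 * B) * (second_smallest_eigenvalue (bipartite_laplacian A) / min l0 l1))
       * (g u v - g_star)"
proof -
  obtain \<mu> where \<mu>: "0 < \<mu>" and ev: "second_smallest_eigenvalue (bipartite_laplacian A) \<le> \<mu>"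
    and gap: "poincare A \<mu>"
    using bipartite_laplacian_spectral_gap[of A] A_nonneg indec by metis
  have le': "g u' v' \<le> g u0 v0" using le by linarith
  have bound: "- (2 * B) \<le> x $ j - y $ i" "x $ j - y $ i \<le> 2 * B" if "g x y \<le> g u0 v0" for x y i j
    using level_set_bound[OF that, of j i] unfolding B by linarith+
  have PL: "2 * (exp (- (2 * B)) * \<mu>) * (g x y - g_star)
      \<le> (\<Sum>j\<in>UNIV. (col_sum x y j - q $ j)\<^sup>2) + (\<Sum>i\<in>UNIV. (row_sum x y i - p $ i)\<^sup>2)"
    (is "_ \<le> ?G") if xy: "g x y \<le> g u0 v0" for x y
  proof -
    \<comment> \<open>The curvature bound is available on the level set; where \<open>g\<close>
      exceeds \<open>g x y\<close> the claim is trivial.\<close>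
    have "g x y - ?G / (2 * (exp (- (2 * B)) * \<mu>)) \<le> g x' y'" for x' y'
    proof (cases "g x' y' \<le> g x y")
      case True
      then have "g x' y' \<le> g u0 v0" using xy by linarith
      from g_minus_le[OF bound(1)[OF xy] bound(1)[OF this] \<mu> gap] show ?thesis by linarith
    next
      case False
      moreover have "0 \<le> ?G / (2 * (exp (- (2 * B)) * \<mu>))" using \<mu> by (simp add: sum_nonneg)
      ultimately show ?thesis by linarith
    qed
    from le_g_star[OF this] show ?thesis using \<mu> by (simp add: field_simps)
  qed
  \<comment> \<open>The exponent \<open>- 4 * B\<close> arises as the curvature factor
    \<open>exp (- (2 * B))\<close> divided by the factor \<open>exp (2 * B)\<close> bounding the
    marginals.\<close>
  have step: "g_next - g_star \<le> (1 - exp (- 4 * B) * (\<mu> / l)) * (g_prev - g_star)"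
    if "S / (2 * (exp (2 * B) * l)) \<le> g_prev - g_next"
      "2 * (exp (- (2 * B)) * \<mu>) * (g_prev - g_star) \<le> S" "0 < l" for S l g_prev g_next
  proof -
    have e: "exp (- 4 * B) = exp (- (2 * B)) / exp (2 * B)" by (simp flip: exp_diff)
    have "exp (- 4 * B) * (\<mu> / l) * (g_prev - g_star)
        = 2 * (exp (- (2 * B)) * \<mu>) * (g_prev - g_star) / (2 * (exp (2 * B) * l))"
      unfolding e by simp
    also have "\<dots> \<le> S / (2 * (exp (2 * B) * l))"
      using that by (intro divide_right_mono) auto
    finally show ?thesis using that by (simp add: algebra_simps)
  qed
  have l0': "(transpose A *v 1) $ j \<le> l0" for j unfolding l0 by (rule Max_ge) auto
  have l1': "(A *v 1) $ i \<le> l1" for i unfolding l1 by (rule Max_ge) auto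
  have c: "col_sum x y j \<le> exp (2 * B) * l0" if "g x y \<le> g u0 v0" for x y j
  proof -
    have "col_sum x y j \<le> exp (2 * B) * (transpose A *v 1) $ j"
      by (rule col_sum_le) (rule bound(2)[OF that])
    also have "\<dots> \<le> exp (2 * B) * l0" by (rule mult_left_mono[OF l0']) simp
    finally show ?thesis .
  qed
  have r: "row_sum x y i \<le> exp (2 * B) * l1" if "g x y \<le> g u0 v0" for x y i
  proof -
    have "row_sum x y i \<le> exp (2 * B) * (A *v 1) $ i"
      by (rule row_sum_le) (rule bound(2)[OF that])
    also have "\<dots> \<le> exp (2 * B) * l1" by (rule mult_left_mono[OF l1']) simp
    finally show ?thesis .
  qed
  have l: "0 < l0" "0 < l1"
    using order_less_le_trans[OF col_sum_pos c[OF le(1)]] order_less_le_trans[OF row_sum_pos r[OF le(1)]]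
    unfolding zero_less_mult_iff by auto
  \<comment> \<open>The required bound on \<open>q $ j\<close> is the column sum bound at
    \<open>(u', v)\<close>, where the column sums equal \<open>q\<close>.\<close>
  have dec: "(\<Sum>j\<in>UNIV. (col_sum u v j - q $ j)\<^sup>2) / (2 * (exp (2 * B) * l0)) \<le> g u v - g u' v"
    by (rule g_decrease_column_update[OF opt(2) c[OF le(1)] c[OF le(2), unfolded opt]])
  have "g u' v - g_star \<le> (1 - exp (- 4 * B) * (\<mu> / l0)) * (g u v - g_star)"
  proof (rule step[OF dec _ l(1)])
    show "2 * (exp (- (2 * B)) * \<mu>) * (g u v - g_star) \<le> (\<Sum>j\<in>UNIV. (col_sum u v j - q $ j)\<^sup>2)"
      using PL[OF le(1)] by (simp add: opt)
  qed
  then have via_l0: "g u' v' - g_star \<le> (1 - exp (- 4 * B) * (\<mu> / l0)) * (g u v - g_star)"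
    using le(3) by linarith
  have l1_step: "g u' v' - g_star \<le> (1 - exp (- 4 * B) * (\<mu> / l1)) * (g u' v - g_star)"
  proof (rule step[OF _ _ l(2)])
    show "(\<Sum>i\<in>UNIV. (row_sum u' v i - p $ i)\<^sup>2) / (2 * (exp (2 * B) * l1)) \<le> g u' v - g u' v'"
      by (rule g_decrease_row_update[OF opt(3) r[OF le(2)] r[OF le', unfolded opt]])
    show "2 * (exp (- (2 * B)) * \<mu>) * (g u' v - g_star) \<le> (\<Sum>i\<in>UNIV. (row_sum u' v i - p $ i)\<^sup>2)"
      using PL[OF le(2)] by (simp add: opt)
  qed
  have g_le: "g u' v \<le> g u v"
    using order_trans[OF _ dec, of 0] l(1) by (simp add: sum_nonneg)
  \<comment> \<open>The two-sided bound at one arbitrary pair of indices forces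
    \<open>B \<ge> 0\<close>.\<close>
  have B0: "0 \<le> B" using bound[OF le(1), of undefined undefined] by linarith
  \<comment> \<open>The bound through \<open>l1\<close> starts from \<open>g u' v\<close>; passing to \<open>g u v\<close> needs a nonnegative factor.\<close>
  have via_l1: "g u' v' - g_star \<le> (1 - exp (- 4 * B) * (\<mu> / l1)) * (g u v - g_star)" if "l1 < l0"
  proof -
    have "\<mu> \<le> l1"
      using that unfolding l0 by (rule gap_le_max_row_sum[OF gap l1'])
    then have "exp (- 4 * B) * (\<mu> / l1) \<le> 1"
      using B0 l(2) \<mu> by (intro mult_le_one) auto
    then have "(1 - exp (- 4 * B) * (\<mu> / l1)) * (g u' v - g_star)
        \<le> (1 - exp (- 4 * B) * (\<mu> / l1)) * (g u v - g_star)"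
      using g_le by (intro mult_left_mono) auto
    with l1_step show ?thesis by linarith
  qed
  have "g u' v' - g_star \<le> (1 - exp (- 4 * B) * (\<mu> / min l0 l1)) * (g u v - g_star)"
    using via_l0 via_l1 by (cases "l1 < l0") (auto simp: min_def)
  \<comment> \<open>The eigenvalue is at most \<open>\<mu>\<close>, so replacing
    \<open>\<mu>\<close> by it does not decrease the factor, and \<open>g u v - g_star\<close> is
    nonnegative.\<close>
  also have "\<dots> \<le> (1 - exp (- 4 * B) *
      (second_smallest_eigenvalue (bipartite_laplacian A) / min l0 l1)) * (g u v - g_star)"
    using l ev g_star_le[of u v]
    by (intro mult_right_mono diff_left_mono mult_left_mono divide_right_mono) auto
  finally show ?thesis .
qed

end

theorem theorem3:
  fixes A :: "real^'m^'n" and p :: "real^'n" and q :: "real^'m"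
    and u :: "nat \<Rightarrow> real^'m" and v :: "nat \<Rightarrow> real^'n"
    and B :: ereal and l0 l1 :: real
  assumes "\<forall>i j. 0 \<le> A $ i $ j"
    and "\<forall>i. 0 < p $ i" and "\<forall>j. 0 < q $ j"
    and "(\<Sum>i\<in>UNIV. p $ i) = (\<Sum>j\<in>UNIV. q $ j)"
    and "strong_existence A p q"
    and "indecomposable A"
    and "sinkhorn_iterates A p q u v"
    and "B = sinkhorn_B A p q (u 0) (v 0)"
    and "l0 = Max (range (\<lambda>j. (transpose A *v 1) $ j))"
    and "l1 = Max (range (\<lambda>i. (A *v 1) $ i))"
  shows "B < \<infinity> \<and>
    (\<forall>t>0. sinkhorn_g A p q (u (t + 1)) (v (t + 1)) - sinkhorn_g_star A p q
      \<le> (1 - exp (- 4 * real_of_ereal B)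
              * (second_smallest_eigenvalue (bipartite_laplacian A) / min l0 l1))
        * (sinkhorn_g A p q (u t) (v t) - sinkhorn_g_star A p q))"
proof (intro conjI allI impI)
  interpret scaling_problem A p q
    using assms(1-6) by unfold_locales simp_all
  show "B < \<infinity>"
    unfolding assms(8) by (rule sinkhorn_B_finite)
  fix t :: nat
  note it = assms(7)[unfolded sinkhorn_iterates_iff_explicit[OF assms(1-3) assms(5)]]
  have row: "row_sum (u t) (v t) i = p $ i" for t i
    by (intro row_sum_optimal) (rule it[THEN conjunct1, rule_format])
  \<comment> \<open>The column constraint holds at the intermediate point, with the new
    \<open>u\<close> and the old \<open>v\<close>.\<close>
  have col: "col_sum (u (Suc t)) (v t) j = q $ j" for t j
    by (intro col_sum_optimal) (rule it[THEN conjunct2, rule_format])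
  have min_v: "g (u t) (v t) \<le> g (u t) y" and min_u: "g (u (Suc t)) (v t) \<le> g x (v t)" for t x y
    using assms(7) by (auto simp: sinkhorn_iterates_def is_arg_min_linorder)
  \<comment> \<open>Each half step minimizes over one block, so \<open>g\<close> never increases and
    the iterates stay in the level set that defines \<open>B\<close>.\<close>
  have level: "g (u t) (v t) \<le> g (u 0) (v 0)" for t
  proof (induction t)
    case (Suc t)
    then show ?case using min_v[of "Suc t" "v t"] min_u[of t "u t"] by linarith
  qed simp
  have level': "g (u (Suc t)) (v t) \<le> g (u 0) (v 0)" for t
    using level[of t] min_u[of t "u t"] by linarith
  show "g (u (t + 1)) (v (t + 1)) - g_star
      \<le> (1 - exp (- 4 * real_of_ereal B)
              * (second_smallest_eigenvalue (bipartite_laplacian A) / min l0 l1))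
        * (g (u t) (v t) - g_star)"
    unfolding assms(8) Suc_eq_plus1[symmetric]
    by (rule sinkhorn_contraction[OF row col row level level' min_v refl assms(9,10)])
qed

end
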